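(* Let $d\ge 1$ be an integer and let $k$ be a field with $\mathrm{char}\,k=0$ or $\mathrm{char}\,k>2d$. Let $A$ be a finite-dimensional unital Jordan algebra over $k$ and let $\varphi:A\to k$ be a nondegenerate form of degree $d$ permitting Jordan composition on $A$. Then: (i) $D_l(\varphi)^2\subset G_l(\varphi)$ for all field extensions $l$ of $k$; that is, $\varphi$ is strongly Jordan multiplicative. (ii) If $d$ is odd, then $D_l(\varphi)=G_l(\varphi)$ (that is, $\varphi_l=\varphi\otimes_kl$ is round) for all field extensions $l$ of $k$, and $\varphi$ is strongly multiplicative.
   Context: A form of degree $d$ on a finite-dimensional $k$-vector space $V$ is a map $\varphi:V\to k$ which in coordinates is given by a homogeneous polynomial of degree $d$ over $k$; it corresponds to a unique symmetric $d$-linear form $\theta$ with $\varphi(v)=\theta(v,\dots,v)$. The form $\varphi$ is nondegenerate if $v=0$ is the only vector with $\theta(v,v_2,\dots,v_d)=0$ for all $v_i\in V$. Two forms of degree $d$ are isomorphic, $\varphi_1\cong\varphi_2$, if there is a bijective linear map $f$ between the underlying spaces with $\varphi_2(f(v))=\varphi_1(v)$. $\varphi$ permits Jordan composition on the unital Jordan algebra $A$ (product written $\cdot$) if $\varphi(1)=1$ and $\varphi(\{vwv\})=\varphi(v)^2\varphi(w)$ for all $v,w\in A$, where $\{vwv\}=2(v\cdot w)\cdot v-w\cdot(v\cdot v)$. For a field extension $l/k$, $\varphi_l$ denotes the form obtained by extension of scalars, $D_l(\varphi)=\{a\in l^\times \mid \varphi_l(x)=a \text{ for some } x\in A\otimes_k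 l\}$, $D_l(\varphi)^2=\{a^2\mid a\in D_l(\varphi)\}$, and $G_l(\varphi)=\{a\in l^\times\mid a\varphi_l\cong\varphi_l\}$. A form is round over a field if its set $D$ over that field is contained in its set $G$. With $n=\dim A$, $X=(x_1,\dots,x_n)$ independent indeterminates, $K=k(X)$ and $\varphi(X)\in K$ the generic value of $\varphi$, $\varphi$ is strongly multiplicative if $\varphi(X)\varphi_K\cong\varphi_K$ over $K$, and strongly Jordan multiplicative if $\varphi(X)^2\varphi_K\cong\varphi_K$ over $K$. *)

theory Defs
  imports
    "HOL-Analysis.Cartesian_Space"
    "HOL-Library.Multiset"
    "HOL-Library.Poly_Mapping"
    "HOL-Computational_Algebra.Fraction_Field"
begin

locale unital_jordan_algebra = vector_space smul
  for smul :: "'k::field \<Rightarrow> 'a::ab_group_add \<Rightarrow> 'a" +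
  fixes mul :: "'a \<Rightarrow> 'a \<Rightarrow> 'a" and e :: 'a
  assumes mul_linear: "Vector_Spaces.linear smul smul (mul x)"
    and mul_commute: "mul x y = mul y x"
    and jordan_identity: "mul (mul x y) (mul x x) = mul x (mul y (mul x x))"
    and mul_unit: "mul e x = x"

definition jordan_triple ::
  "('k::field \<Rightarrow> 'a::ab_group_add \<Rightarrow> 'a) \<Rightarrow> ('a \<Rightarrow> 'a \<Rightarrow> 'a) \<Rightarrow> 'a \<Rightarrow> 'a \<Rightarrow> 'a" where
  "jordan_triple smul mul v w = smul 2 (mul (mul v w) v) - mul w (mul v v)"

definition permits_jordan_composition ::
  "('k::field \<Rightarrow> 'a::ab_group_add \<Rightarrow> 'a) \<Rightarrow> ('a \<Rightarrow> 'a \<Rightarrow> 'a) \<Rightarrow> 'a \<Rightarrow> ('a \<Rightarrow> 'k) \<Rightarrow> bool" where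
  "permits_jordan_composition smul mul e \<phi> \<longleftrightarrow>
     \<phi> e = 1 \<and> (\<forall>v w. \<phi> (jordan_triple smul mul v w) = (\<phi> v)\<^sup>2 * \<phi> w)"

text \<open>
  A polynomial in the finitely many indeterminates \<open>x\<^sub>i\<close> (\<open>i :: 'n\<close>) is a finitely supported
  map from exponent vectors \<open>'n \<Rightarrow>\<^sub>0 nat\<close> to coefficients, with the convolution product of
  \<^theory>\<open>HOL-Library.Poly_Mapping\<close>.
\<close>

type_synonym ('n, 'k) mpoly = "('n \<Rightarrow>\<^sub>0 nat) \<Rightarrow>\<^sub>0 'k"

definition homogeneous :: "nat \<Rightarrow> ('n::finite, 'k::zero) mpoly \<Rightarrow> bool" where
  "homogeneous d p \<longleftrightarrow> (\<forall>m \<in> Poly_Mapping.keys p. (\<Sum>i\<in>UNIV. Poly_Mapping.lookup m i) = d)"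

definition mpoly_eval :: "('n::finite, 'k::comm_semiring_1) mpoly \<Rightarrow> 'k ^ 'n \<Rightarrow> 'k" where
  "mpoly_eval p x =
     (\<Sum>m \<in> Poly_Mapping.keys p. Poly_Mapping.lookup p m * (\<Prod>i\<in>UNIV. (x $ i) ^ Poly_Mapping.lookup m i))"

definition indexed_basis ::
  "('k::field \<Rightarrow> 'a::ab_group_add \<Rightarrow> 'a) \<Rightarrow> ('n::finite \<Rightarrow> 'a) \<Rightarrow> bool" where
  "indexed_basis smul b \<longleftrightarrow> inj b \<and> finite_dimensional_vector_space smul (range b)"

text \<open>
  \<open>is_form smul b d p \<phi>\<close>: the map \<open>\<phi>\<close> is a form of degree \<open>d\<close>, given by the homogeneous
  polynomial \<open>p\<close> in the coordinates with respect to the basis \<open>b\<close>.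
\<close>

definition is_form ::
  "('k::field \<Rightarrow> 'a::ab_group_add \<Rightarrow> 'a) \<Rightarrow> ('n::finite \<Rightarrow> 'a) \<Rightarrow> nat \<Rightarrow> ('n, 'k) mpoly \<Rightarrow> ('a \<Rightarrow> 'k) \<Rightarrow> bool"
  where
  "is_form smul b d p \<phi> \<longleftrightarrow>
     homogeneous d p \<and> (\<forall>x :: 'k ^ 'n. \<phi> (\<Sum>i\<in>UNIV. smul (x $ i) (b i)) = mpoly_eval p x)"

text \<open>A \<open>d\<close>-linear form is a function on lists, of which only the values on lists of length
  \<open>d\<close> matter.\<close>

definition symmetric_multilinear ::
  "('k::field \<Rightarrow> 'a::ab_group_add \<Rightarrow> 'a) \<Rightarrow> nat \<Rightarrow> ('a list \<Rightarrow> 'k) \<Rightarrow> bool" where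
  "symmetric_multilinear smul d \<theta> \<longleftrightarrow>
     (\<forall>vs i. length vs = d \<longrightarrow> i < d \<longrightarrow> Vector_Spaces.linear smul (*) (\<lambda>v. \<theta> (vs[i := v]))) \<and>
     (\<forall>vs ws. length vs = d \<longrightarrow> mset ws = mset vs \<longrightarrow> \<theta> ws = \<theta> vs)"

text \<open>The form \<open>\<theta>\<close> is unique on lists of length \<open>d\<close> when \<open>d!\<close> is invertible in the base
  field, so that the existential quantifier could equally be a universal one.\<close>

definition nondegenerate_form ::
  "('k::field \<Rightarrow> 'a::ab_group_add \<Rightarrow> 'a) \<Rightarrow> nat \<Rightarrow> ('a \<Rightarrow> 'k) \<Rightarrow> bool" where
  "nondegenerate_form smul d \<phi> \<longleftrightarrow>
     (\<exists>\<theta>. symmetric_multilinear smul d \<theta> \<and> (\<forall>v. \<phi> v = \<theta> (replicate d v)) \<and>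
          (\<forall>v. (\<forall>vs. length vs = d - 1 \<longrightarrow> \<theta> (v # vs) = 0) \<longrightarrow> v = 0))"

definition field_embedding :: "('k::field \<Rightarrow> 'l::field) \<Rightarrow> bool" where
  "field_embedding \<iota> \<longleftrightarrow>
     \<iota> 1 = 1 \<and> (\<forall>x y. \<iota> (x + y) = \<iota> x + \<iota> y) \<and> (\<forall>x y. \<iota> (x * y) = \<iota> x * \<iota> y)"

text \<open>
  The basis \<open>b i\<close> of \<open>A\<close> gives the basis \<open>b i \<otimes> 1\<close> of the scalar extension \<open>A \<otimes> l\<close>, which is
  thereby identified with \<open>l ^ 'n\<close>. The extended form is given by the same polynomial, its
  coefficients being read in \<open>l\<close>.
\<close>

definition extend_form :: "('k::field \<Rightarrow> 'l::field) \<Rightarrow> ('n::finite, 'k) mpoly \<Rightarrow> 'l ^ 'n \<Rightarrow> 'l" where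
  "extend_form \<iota> p = mpoly_eval (Poly_Mapping.map \<iota> p)"

definition forms_isomorphic :: "('l::field ^ 'm \<Rightarrow> 'l) \<Rightarrow> ('l ^ 'n \<Rightarrow> 'l) \<Rightarrow> bool" where
  "forms_isomorphic \<phi>1 \<phi>2 \<longleftrightarrow>
     (\<exists>f. Vector_Spaces.linear (*s) (*s) f \<and> bij f \<and> (\<forall>v. \<phi>2 (f v) = \<phi>1 v))"

definition D_set :: "('l::field ^ 'n \<Rightarrow> 'l) \<Rightarrow> 'l set" where
  "D_set \<phi> = {a. a \<noteq> 0 \<and> (\<exists>x. \<phi> x = a)}"

definition G_set :: "('l::field ^ 'n \<Rightarrow> 'l) \<Rightarrow> 'l set" where
  "G_set \<phi> = {a. a \<noteq> 0 \<and> forms_isomorphic (\<lambda>x. a * \<phi> x) \<phi>}"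

definition round_form :: "('l::field ^ 'n \<Rightarrow> 'l) \<Rightarrow> bool" where
  "round_form \<phi> \<longleftrightarrow> D_set \<phi> \<subseteq> G_set \<phi>"

text \<open>
  The field of rational functions in the indeterminates \<open>x\<^sub>i\<close> (\<open>i :: 'n\<close>). The order on \<open>'n\<close>
  serves only to make the polynomial ring an instance of class \<open>idom\<close>.
\<close>

type_synonym ('n, 'k) ratfun = "('n, 'k) mpoly fract"

definition ratfun_const :: "'k::field \<Rightarrow> ('n::{finite,linorder}, 'k) ratfun" where
  "ratfun_const c = Fraction_Field.Fract (Poly_Mapping.single 0 c) 1"

definition ratfun_var :: "'n::{finite,linorder} \<Rightarrow> ('n, 'k::field) ratfun" where
  "ratfun_var i = Fraction_Field.Fract (Poly_Mapping.single (Poly_Mapping.single i 1) 1) 1"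

definition extend_generic ::
  "('n::{finite,linorder}, 'k::field) mpoly \<Rightarrow> (('n, 'k) ratfun, 'n) vec \<Rightarrow> ('n, 'k) ratfun" where
  "extend_generic p = extend_form ratfun_const p"

definition generic_value ::
  "('n::{finite,linorder}, 'k::field) mpoly \<Rightarrow> ('n, 'k) ratfun" where
  "generic_value p = extend_generic p (\<chi> i. ratfun_var i)"

definition strongly_multiplicative :: "('n::{finite,linorder}, 'k::field) mpoly \<Rightarrow> bool" where
  "strongly_multiplicative p \<longleftrightarrow>
     forms_isomorphic (\<lambda>x. generic_value p * extend_generic p x) (extend_generic p)"

definition strongly_jordan_multiplicative :: "('n::{finite,linorder}, 'k::field) mpoly \<Rightarrow> bool" where
  "strongly_jordan_multiplicative p \<longleftrightarrow>
     forms_isomorphic (\<lambda>x. (generic_value p)\<^sup>2 * extend_generic p x) (extend_generic p)"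

end

theory Submission
  imports Defs "HOL-Computational_Algebra.Polynomial"
begin

text \<open>
  Write \<open>U\<^sub>x w = {x w x}\<close>. Over \<open>k\<close> the form satisfies \<open>\<phi> (U\<^sub>x w) = \<phi> x ^ 2 * \<phi> w\<close>, and everything
  follows once this law and the injectivity of \<open>U\<^sub>x\<close> for \<open>\<phi> x \<noteq> 0\<close> are known over every extension
  \<open>l\<close>: then \<open>U\<^sub>x\<close> is a linear bijection multiplying the form by \<open>\<phi> x ^ 2\<close>, so squares of values
  are multipliers. A nonzero scalar \<open>c\<close> multiplies the form by \<open>c ^ d\<close>; for odd \<open>d\<close> the map
  \<open>w \<mapsto> inverse a *s (U\<^sub>x ^^ ((d + 1) div 2)) w\<close> with \<open>a = \<phi> x\<close> multiplies it by
  \<open>a ^ (d + 1) / a ^ d = a\<close>, so all nonzero values are multipliers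
  (\<open>odd_degree_similarity\<close>). Conversely, a multiplier \<open>a\<close> is the value at the image of the unit.

  The composition law passes to \<open>l\<close> (\<open>extended_form_composition\<close>) because both sides are polynomials
  of degree at most \<open>2 d\<close> in \<open>x\<close> and \<open>d\<close> in \<open>w\<close>, while \<open>k\<close> has more than \<open>2 d\<close> elements: the
  coordinates of a point can be moved from \<open>k\<close> to \<open>l\<close> one at a time, each step being about a
  univariate polynomial with more roots than its degree (\<open>zero_if_zero_on_grid\<close>).

  Injectivity comes from nondegeneracy. If \<open>U\<^sub>x v = 0\<close> and \<open>\<phi> x \<noteq> 0\<close>, the composition law gives
  \<open>\<phi> (w + t v) = \<phi> w\<close> for all \<open>w\<close> and \<open>t\<close>, so \<open>v\<close> is orthogonal to the gradients of \<open>\<phi>\<close>, in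
  particular to those at points over \<open>k\<close>. The latter conditions are linear with coefficients in
  \<open>k\<close>, so a nonzero solution over \<open>l\<close> is turned into a nonzero solution over \<open>k\<close> by a \<open>k\<close>-linear
  functional on \<open>l\<close> (\<open>zero_if_translation_invariant\<close>). Over \<open>k\<close>, polarization, which divides by
  numbers up to \<open>d\<close> only, identifies such solutions with the radical of the symmetric \<open>d\<close>-linear form
  (\<open>zero_if_orthogonal_to_gradients\<close>), which is zero.

  For strong multiplicativity the extension is the field of rational functions. There the generic
  value is the fraction \<open>p / 1\<close>, which is nonzero and hence one of the values of the extended form.
\<close>

section \<open>Extension of scalars along a field embedding\<close>

context
  fixes \<iota> :: "'k::field \<Rightarrow> 'l::field"
  assumes emb: "field_embedding \<iota>"
begin

lemma embedding_one: "\<iota> 1 = 1"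
  and embedding_add: "\<iota> (x + y) = \<iota> x + \<iota> y"
  and embedding_mult: "\<iota> (x * y) = \<iota> x * \<iota> y"
  using emb by (auto simp: field_embedding_def)

lemma embedding_zero: "\<iota> 0 = 0"
  by (metis add.right_neutral add_left_cancel embedding_add)

lemma embedding_eq_0_iff: "\<iota> x = 0 \<longleftrightarrow> x = 0"
proof
  assume "\<iota> x = 0"
  then have "\<iota> (x * inverse x) = 0" by (simp add: embedding_mult)
  then show "x = 0" by (metis embedding_one right_inverse zero_neq_one)
qed (simp add: embedding_zero)

lemma embedding_eq_iff: "\<iota> x = \<iota> y \<longleftrightarrow> x = y"
  using embedding_eq_0_iff[of "x - y"] embedding_add[of "x - y" y] by auto

lemma embedding_sum: "\<iota> (sum f S) = (\<Sum>s\<in>S. \<iota> (f s))"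
  by (induction S rule: infinite_finite_induct) (simp_all add: embedding_zero embedding_add)

lemma embedding_prod: "\<iota> (prod f S) = (\<Prod>s\<in>S. \<iota> (f s))"
  by (induction S rule: infinite_finite_induct) (simp_all add: embedding_one embedding_mult)

lemma embedding_power: "\<iota> (x ^ n) = \<iota> x ^ n"
  by (induction n) (simp_all add: embedding_one embedding_mult)

lemma embedding_of_nat: "\<iota> (of_nat n) = of_nat n"
  by (induction n) (simp_all add: embedding_zero embedding_add embedding_one)

lemmas embedding_simps = embedding_zero embedding_one embedding_add embedding_mult
  embedding_sum embedding_prod embedding_power embedding_of_nat

lemma keys_extended_coefficients:
  "Poly_Mapping.keys (Poly_Mapping.map \<iota> p) = Poly_Mapping.keys p"
  by (auto simp: Poly_Mapping.in_keys_iff Poly_Mapping.map.rep_eq when_def embedding_eq_0_iff)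

lemma extend_form_expand:
  "extend_form \<iota> p x = (\<Sum>m \<in> Poly_Mapping.keys p. \<iota> (Poly_Mapping.lookup p m) *
     (\<Prod>i\<in>UNIV. (x $ i) ^ Poly_Mapping.lookup m i))"
  unfolding extend_form_def mpoly_eval_def keys_extended_coefficients
  by (intro sum.cong refl) (simp add: Poly_Mapping.map.rep_eq Poly_Mapping.in_keys_iff when_def)

end

lemma field_embedding_id: "field_embedding id"
  by (simp add: field_embedding_def)

lemma mpoly_eval_extend_id: "mpoly_eval p x = extend_form id p x"
  by (simp add: extend_form_expand[OF field_embedding_id] mpoly_eval_def)

definition extend_point :: "('k::field \<Rightarrow> 'l::field) \<Rightarrow> 'k ^ 'n \<Rightarrow> 'l ^ 'n" where
  "extend_point \<iota> x = (\<chi> i. \<iota> (x $ i))"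

lemma extend_point_nth [simp]: "extend_point \<iota> x $ i = \<iota> (x $ i)"
  by (simp add: extend_point_def)

lemma extend_form_extend_point:
  assumes "field_embedding \<iota>"
  shows "extend_form \<iota> p (extend_point \<iota> x) = \<iota> (mpoly_eval p x)"
  by (simp add: extend_form_expand[OF assms] mpoly_eval_def embedding_simps[OF assms])

lemma extend_form_scale:
  assumes "field_embedding \<iota>" "homogeneous d p"
  shows "extend_form \<iota> p (c *s x) = c ^ d * extend_form \<iota> p x"
proof -
  have "(\<Prod>i\<in>UNIV. c ^ Poly_Mapping.lookup m i) = c ^ d" if "m \<in> Poly_Mapping.keys p" for m
    using assms(2) that by (simp add: homogeneous_def power_sum[symmetric])
  then show ?thesis
    by (simp add: extend_form_expand[OF assms(1)] power_mult_distrib prod.distrib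
        sum_distrib_left mult.left_commute)
qed

section \<open>Forms restricted to polynomial curves\<close>

definition form_along_curve ::
  "('k::field \<Rightarrow> 'l::field) \<Rightarrow> ('n::finite, 'k) mpoly \<Rightarrow> ('n \<Rightarrow> 'l poly) \<Rightarrow> 'l poly" where
  "form_along_curve \<iota> p P = (\<Sum>m \<in> Poly_Mapping.keys p. smult (\<iota> (Poly_Mapping.lookup p m))
     (\<Prod>i\<in>UNIV. P i ^ Poly_Mapping.lookup m i))"

lemma poly_form_along_curve:
  assumes "field_embedding \<iota>"
  shows "poly (form_along_curve \<iota> p P) t = extend_form \<iota> p (\<chi> i. poly (P i) t)"
  by (simp add: form_along_curve_def extend_form_expand[OF assms] poly_sum poly_prod)

lemma degree_form_along_curve:
  fixes P :: "'n::finite \<Rightarrow> 'l::field poly"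
  assumes p: "homogeneous d p" and P: "\<And>i. degree (P i) \<le> r"
  shows "degree (form_along_curve \<iota> p P) \<le> r * d"
  unfolding form_along_curve_def
proof (rule degree_sum_le)
  fix m assume m: "m \<in> Poly_Mapping.keys p"
  have "degree (\<Prod>i\<in>UNIV. P i ^ Poly_Mapping.lookup m i)
      \<le> (\<Sum>i\<in>UNIV. degree (P i ^ Poly_Mapping.lookup m i))"
    by (rule degree_prod_sum_le[unfolded o_def]) simp
  also have "\<dots> \<le> (\<Sum>i\<in>UNIV. r * Poly_Mapping.lookup m i)"
    by (intro sum_mono order_trans[OF degree_power_le] mult_le_mono P order_refl)
  also have "\<dots> = r * d"
    using p m by (simp add: homogeneous_def sum_distrib_left[symmetric])
  finally show "degree (smult (\<iota> (Poly_Mapping.lookup p m))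
      (\<Prod>i\<in>UNIV. P i ^ Poly_Mapping.lookup m i)) \<le> r * d"
    using degree_smult_le order_trans by blast
qed simp

text \<open>The value at \<open>x\<close> of the formal partial derivative with respect to the \<open>i\<close>-th indeterminate.\<close>

definition partial_value ::
  "('k::field \<Rightarrow> 'l::field) \<Rightarrow> ('n::finite, 'k) mpoly \<Rightarrow> 'n \<Rightarrow> 'l ^ 'n \<Rightarrow> 'l" where
  "partial_value \<iota> p i x = (\<Sum>m \<in> Poly_Mapping.keys p. \<iota> (Poly_Mapping.lookup p m) *
     (of_nat (Poly_Mapping.lookup m i) * (x $ i) ^ (Poly_Mapping.lookup m i - 1) *
       (\<Prod>j\<in>UNIV - {i}. (x $ j) ^ Poly_Mapping.lookup m j)))"

lemma partial_value_extend_point: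
  assumes "field_embedding \<iota>"
  shows "partial_value \<iota> p i (extend_point \<iota> x) = \<iota> (partial_value id p i x)"
  by (simp add: partial_value_def embedding_simps[OF assms])

text \<open>The coefficient of \<open>t\<close> along \<open>x + t y\<close> is the derivative in direction \<open>y\<close>. Expressed by
  formal partial derivatives it is visibly linear in \<open>y\<close> over the extension field, with
  coefficients in the base field when \<open>x\<close> is a base field point.\<close>

lemma form_along_line:
  assumes emb: "field_embedding \<iota>" and p: "homogeneous d p"
  obtains q where "degree q \<le> d" "\<And>t. extend_form \<iota> p (x + t *s y) = poly q t"
    "coeff q 1 = (\<Sum>i\<in>UNIV. y $ i * partial_value \<iota> p i x)"
proof
  let ?q = "form_along_curve \<iota> p (\<lambda>i. [:x $ i, y $ i:])"
  show "degree ?q \<le> d"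
    using degree_form_along_curve[OF p, of "\<lambda>i. [:x $ i, y $ i:]" 1 \<iota>] by simp
  show "extend_form \<iota> p (x + t *s y) = poly ?q t" for t
    by (simp add: poly_form_along_curve[OF emb] plus_vec_def vector_scalar_mult_def)
  have coeff_1: "coeff q 1 = poly (pderiv q) 0" for q :: "'b poly"
    by (simp add: poly_0_coeff_0 coeff_pderiv)
  have "coeff ?q 1 = (\<Sum>m \<in> Poly_Mapping.keys p. \<Sum>i\<in>UNIV. y $ i * (\<iota> (Poly_Mapping.lookup p m) *
     (of_nat (Poly_Mapping.lookup m i) * (x $ i) ^ (Poly_Mapping.lookup m i - 1) *
       (\<Prod>j\<in>UNIV - {i}. (x $ j) ^ Poly_Mapping.lookup m j))))"
    unfolding form_along_curve_def coeff_sum unfolding coeff_1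
    by (simp add: pderiv_smult pderiv_prod pderiv_power pderiv_pCons poly_sum poly_prod
        sum_distrib_left mult_ac)
  also have "\<dots> = (\<Sum>i\<in>UNIV. y $ i * partial_value \<iota> p i x)"
    unfolding partial_value_def sum_distrib_left by (rule sum.swap)
  finally show "coeff ?q 1 = (\<Sum>i\<in>UNIV. y $ i * partial_value \<iota> p i x)" .
qed

section \<open>Polynomial identities on a large grid\<close>

text \<open>A notion of polynomial function that bounds the degree without reference to coefficients. It
  is what a change of a single coordinate needs.\<close>

definition polynomial_along_lines :: "nat \<Rightarrow> ('l::field ^ 'n \<Rightarrow> 'l) \<Rightarrow> bool" where
  "polynomial_along_lines D g \<longleftrightarrow>
     (\<forall>x y. \<exists>q. degree q \<le> D \<and> (\<forall>t. g (x + t *s y) = poly q t))"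

lemma poly_zero_if_many_roots:
  fixes q :: "'l::field poly"
  assumes "degree q < card C" "\<And>c. c \<in> C \<Longrightarrow> poly q c = 0"
  shows "q = 0"
proof (rule ccontr)
  assume "q \<noteq> 0"
  then have "card C \<le> card {c. poly q c = 0}" "card {c. poly q c = 0} \<le> degree q"
    using assms(2) by (auto intro!: card_mono poly_roots_finite card_poly_roots_bound)
  then show False using assms(1) by simp
qed

text \<open>One coordinate after the other is freed from the grid: with the other coordinates held
  fixed, the function is a polynomial in one variable with more roots than its degree.\<close>

lemma zero_if_zero_on_grid:
  fixes g :: "'l::field ^ 'n::finite \<Rightarrow> 'l"
  assumes g: "polynomial_along_lines D g" and C: "D < card C"
    and zero: "\<And>x. (\<forall>i. x $ i \<in> C) \<Longrightarrow> g x = 0"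
  shows "g x = 0"
proof -
  have "\<forall>x. (\<forall>i. i \<notin> S \<longrightarrow> x $ i \<in> C) \<longrightarrow> g x = 0" if "finite S" for S
    using that
  proof induction
    case empty
    then show ?case using zero by simp
  next
    case (insert a S)
    show ?case
    proof (intro allI impI)
      fix x :: "'l ^ 'n" assume x: "\<forall>i. i \<notin> insert a S \<longrightarrow> x $ i \<in> C"
      define x0 where "x0 = (\<chi> i. if i = a then 0 else x $ i)"
      obtain q where q: "degree q \<le> D" "\<And>t. g (x0 + t *s axis a 1) = poly q t"
        using g unfolding polynomial_along_lines_def by blast
      have "poly q c = 0" if "c \<in> C" for c
      proof -
        have "\<forall>i. i \<notin> S \<longrightarrow> (x0 + c *s axis a 1) $ i \<in> C"
          using x that by (auto simp: x0_def axis_def)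
        then show ?thesis using insert.IH by (simp flip: q(2))
      qed
      then have "q = 0" using q(1) C by (intro poly_zero_if_many_roots[of q C]) auto
      moreover have "x = x0 + x $ a *s axis a 1"
        by (simp add: x0_def axis_def vec_eq_iff)
      ultimately show "g x = 0" using q(2)[of "x $ a"] by simp
    qed
  qed
  from this[of UNIV] show ?thesis by simp
qed

text \<open>The grids are built from the elements \<open>0, \<dots>, N\<close> of the prime field, which lie in every
  extension and are pairwise distinct under the assumption on the characteristic.\<close>

lemma inj_on_of_nat_below_characteristic:
  assumes "CHAR('k::field) = 0 \<or> CHAR('k) > N"
  shows "inj_on (of_nat :: nat \<Rightarrow> 'k) {..N}"
proof (rule linorder_inj_onI)
  fix i j :: nat assume ij: "i < j" "i \<in> {..N}" "j \<in> {..N}"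
  then have "\<not> CHAR('k) dvd j - i"
    using assms by (auto dest: dvd_imp_le)
  then show "(of_nat i :: 'k) \<noteq> of_nat j"
    using ij of_nat_diff[of i j, where 'a = 'k] by (auto simp: of_nat_eq_0_iff_char_dvd[symmetric])
qed auto

lemma card_of_nat_grid:
  assumes "CHAR('k::field) = 0 \<or> CHAR('k) > N"
  shows "card ((of_nat :: nat \<Rightarrow> 'k) ` {..N}) = Suc N"
  by (simp add: card_image inj_on_of_nat_below_characteristic[OF assms])

lemma card_of_nat_grid_extension:
  fixes \<iota> :: "'k::field \<Rightarrow> 'l::field"
  assumes "CHAR('k) = 0 \<or> CHAR('k) > N" and emb: "field_embedding \<iota>"
  shows "card (\<iota> ` of_nat ` {..N}) = Suc N"
  using card_of_nat_grid[OF assms(1)]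
  by (subst card_image) (auto simp: inj_on_def embedding_eq_iff[OF emb])


section \<open>Polarization and the radical of a form\<close>

text \<open>The linear coefficient of the expansion along a line is, up to the factor \<open>m\<close>, a polar of the
  form; the constant one is recorded because the induction for the linear one uses it. The induction moves one argument from the repeated block to the fixed
  arguments \<open>us\<close>.\<close>

lemma multilinear_along_line:
  assumes "symmetric_multilinear smul d \<theta>" "length us + m = d"
  shows "\<exists>q. degree q \<le> m \<and> coeff q 0 = \<theta> (us @ replicate m w) \<and>
    coeff q 1 = of_nat m * \<theta> (us @ z # replicate (m - 1) w) \<and>
    (\<forall>t. \<theta> (us @ replicate m (w + smul t z)) = poly q t)"
  using assms(2)
proof (induction m arbitrary: us)
  case 0
  then show ?case by (intro exI[of _ "[:\<theta> us:]"]) simp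
next
  case (Suc m)
  have symmetric: "\<theta> ws = \<theta> vs" if "length vs = d" "mset ws = mset vs" for vs ws
    using assms(1) that unfolding symmetric_multilinear_def by blast
  have split: "\<theta> (us @ (w + smul t z) # vs) = \<theta> (us @ w # vs) + t * \<theta> (us @ z # vs)"
    if "length vs = m" for vs t
  proof -
    have "Vector_Spaces.linear smul (*) (\<lambda>v. \<theta> (vs[i := v]))"
      if "length vs = d" "i < d" for vs i
      using assms(1) that unfolding symmetric_multilinear_def by blast
    from this[of "us @ w # vs" "length us"]
    interpret slot: Vector_Spaces.linear smul "(*)" "\<lambda>v. \<theta> (us @ v # vs)"
      using Suc.prems that by simp
    show ?thesis by (simp add: slot.add slot.scale)
  qed
  obtain q1 where q1: "degree q1 \<le> m" "coeff q1 0 = \<theta> ((us @ [w]) @ replicate m w)"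
      "coeff q1 1 = of_nat m * \<theta> ((us @ [w]) @ z # replicate (m - 1) w)"
      "\<And>t. \<theta> ((us @ [w]) @ replicate m (w + smul t z)) = poly q1 t"
    using Suc.IH[of "us @ [w]"] Suc.prems by auto
  obtain q2 where q2: "degree q2 \<le> m" "coeff q2 0 = \<theta> ((us @ [z]) @ replicate m w)"
      "\<And>t. \<theta> ((us @ [z]) @ replicate m (w + smul t z)) = poly q2 t"
    using Suc.IH[of "us @ [z]"] Suc.prems by auto
  let ?q = "q1 + pCons 0 q2"
  have "of_nat m * \<theta> (us @ w # z # replicate (m - 1) w) = of_nat m * \<theta> (us @ z # replicate m w)"
  proof (cases m)
    case (Suc l)
    then have "\<theta> (us @ w # z # replicate (m - 1) w) = \<theta> (us @ z # replicate m w)"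
      using Suc.prems \<open>length us + Suc m = d\<close> by (intro symmetric) auto
    then show ?thesis by simp
  qed simp
  then have "coeff ?q 1 = of_nat (Suc m) * \<theta> (us @ z # replicate m w)"
    using q1(3) q2(2) by (simp add: algebra_simps)
  moreover have "degree ?q \<le> Suc m"
    using q1(1) q2(1) by (intro degree_add_le) (auto intro: order_trans[OF degree_pCons_le])
  moreover have "\<theta> (us @ replicate (Suc m) (w + smul t z)) = poly ?q t" for t
    using split[of "replicate m (w + smul t z)" t] q1(4)[of t] q2(3)[of t] by simp
  ultimately show ?case using q1(2) by (intro exI[of _ ?q]) simp
qed

text \<open>If the first polar of the form vanishes in direction \<open>v\<close>, then so do all further polars in
  that direction: an argument equal to \<open>w\<close> is replaced by \<open>z\<close> by looking at the linear
  coefficient along \<open>w + t z\<close>. That coefficient carries a factor equal to the number of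
  repeated arguments, at most \<open>d\<close> and therefore invertible.\<close>

lemma radical_if_first_polar_zero:
  fixes smul :: "'k::field \<Rightarrow> 'a::ab_group_add \<Rightarrow> 'a"
  assumes sym: "symmetric_multilinear smul d \<theta>"
    and char: "CHAR('k) = 0 \<or> CHAR('k) > d"
    and polar: "\<And>w. \<theta> (v # replicate (d - 1) w) = 0"
    and vs: "length vs = d - 1" and d: "d \<ge> 1"
  shows "\<theta> (v # vs) = 0"
proof -
  have "\<theta> (v # us @ replicate m w) = 0" if "length us + m = d - 1" for us m w
    using that
  proof (induction us arbitrary: m w rule: rev_induct)
    case Nil
    then show ?case using polar by simp
  next
    case (snoc z us)
    obtain q where q: "degree q \<le> Suc m"
      "coeff q 1 = of_nat (Suc m) * \<theta> ((v # us) @ z # replicate m w)"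
      "\<And>t. \<theta> ((v # us) @ replicate (Suc m) (w + smul t z)) = poly q t"
      using multilinear_along_line[OF sym, of "v # us" "Suc m" w z] snoc.prems d by auto
    have "poly q t = 0" for t
      using snoc.IH[of "Suc m" "w + smul t z"] snoc.prems q(3)[of t] by simp
    then have "q = 0"
      using q(1) snoc.prems card_of_nat_grid[OF char]
      by (intro poly_zero_if_many_roots[of q "of_nat ` {..d}"]) auto
    moreover have "\<not> CHAR('k) dvd Suc m"
      using char snoc.prems by (auto dest: dvd_imp_le)
    then have "(of_nat (Suc m) :: 'k) \<noteq> 0"
      using of_nat_eq_0_iff_char_dvd by blast
    ultimately show ?case using q(2) by (simp del: of_nat_Suc)
  qed
  from this[of vs 0] show ?thesis using vs by simp
qed

section \<open>Linear similarities\<close>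

lemma similarity_in_G_set:
  fixes f :: "'l::field ^ 'n::finite \<Rightarrow> 'l ^ 'n"
  assumes "Vector_Spaces.linear (*s) (*s) f" "inj f" "a \<noteq> 0" "\<And>v. F (f v) = a * F v"
  shows "a \<in> G_set F"
  using assms vec.linear_injective_imp_surjective[of f]
  unfolding G_set_def forms_isomorphic_def bij_def by auto

lemma linear_funpow:
  fixes f :: "'l::field ^ 'n::finite \<Rightarrow> 'l ^ 'n"
  assumes "Vector_Spaces.linear (*s) (*s) f"
  shows "Vector_Spaces.linear (*s) (*s) (f ^^ m)"
proof (induction m)
  case 0
  then show ?case using vec.linear_id by (simp add: id_def)
next
  case (Suc m)
  then show ?case using Vector_Spaces.linear_compose[OF Suc assms] by (simp add: o_def)
qed

text \<open>A scalar \<open>c\<close> is a similarity of multiplier \<open>c ^ d\<close>. Iterating a similarity of multiplier \<open>a\<^sup>2\<close>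
  exactly \<open>(d + 1) / 2\<close> times, which is an integer for odd \<open>d\<close>, and dividing by \<open>a\<close> leaves the
  multiplier \<open>a ^ (d + 1) / a ^ d = a\<close>.\<close>

lemma odd_degree_similarity:
  fixes f :: "'l::field ^ 'n::finite \<Rightarrow> 'l ^ 'n"
  assumes f: "Vector_Spaces.linear (*s) (*s) f" "inj f" "\<And>v. F (f v) = a\<^sup>2 * F v"
    and hom: "\<And>c v. F (c *s v) = c ^ d * F v" and "odd d" "a \<noteq> 0"
  shows "a \<in> G_set F"
proof -
  define m where "m = (d + 1) div 2"
  have m: "2 * m = Suc d" using \<open>odd d\<close> by (simp add: m_def)
  let ?g = "\<lambda>v. inverse a *s (f ^^ m) v"
  have iterate: "F ((f ^^ j) v) = a ^ (2 * j) * F v" for j v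
    by (induction j) (simp_all add: f(3) power2_eq_square mult_ac)
  show ?thesis
  proof (rule similarity_in_G_set)
    show "Vector_Spaces.linear (*s) (*s) ?g"
      using vec.linear_compose_scale_right[OF linear_funpow[OF f(1)]] .
    show "inj ?g"
      using inj_fn[OF f(2), of m] \<open>a \<noteq> 0\<close> by (auto simp: inj_def)
    show "F (?g v) = a * F v" for v
      using \<open>a \<noteq> 0\<close> by (simp add: hom iterate m power_inverse)
  qed fact
qed


section \<open>Extending the scalars of the Jordan algebra\<close>

locale jordan_composition_form = unital_jordan_algebra smul mul e
  for smul :: "'k::field \<Rightarrow> 'a::ab_group_add \<Rightarrow> 'a" and mul :: "'a \<Rightarrow> 'a \<Rightarrow> 'a" and e :: 'a +
  fixes b :: "'n::finite \<Rightarrow> 'a" and d :: nat and p :: "('n, 'k) mpoly" and \<phi> :: "'a \<Rightarrow> 'k"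
  assumes degree_pos: "d \<ge> 1"
    and char: "CHAR('k) = 0 \<or> CHAR('k) > 2 * d"
    and basis: "indexed_basis smul b"
    and form: "is_form smul b d p \<phi>"
    and nondegenerate: "nondegenerate_form smul d \<phi>"
    and composition: "permits_jordan_composition smul mul e \<phi>"
begin

definition combination :: "'k ^ 'n \<Rightarrow> 'a" where
  "combination x = (\<Sum>i\<in>UNIV. smul (x $ i) (b i))"

lemma combination_add: "combination (x + y) = combination x + combination y"
  by (simp add: combination_def scale_left_distrib sum.distrib)

lemma combination_scale: "combination (c *s x) = smul c (combination x)"
  by (simp add: combination_def scale_sum_right)

lemma combination_sum: "combination (sum f S) = (\<Sum>s\<in>S. combination (f s))"
proof -
  have "combination 0 = 0" by (simp add: combination_def)
  then show ?thesis
    by (induction S rule: infinite_finite_induct) (simp_all add: combination_add)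
qed

lemma combination_basis: "inj b" "independent (range b)" "span (range b) = UNIV"
proof -
  show "inj b" using basis by (simp add: indexed_basis_def)
  interpret finite_dimensional_vector_space smul "range b"
    using basis by (simp add: indexed_basis_def)
  show "independent (range b)" "span (range b) = UNIV"
    by (rule independent_Basis, rule span_Basis)
qed

lemma combination_eq_0: "combination x = 0 \<Longrightarrow> x = 0"
proof -
  assume "combination x = 0"
  then have "(\<Sum>v\<in>range b. smul (x $ inv b v) v) = 0"
    using combination_basis(1) by (simp add: combination_def sum.reindex)
  then have "x $ inv b (b i) = 0" for i
    by (intro independentD[OF combination_basis(2), of "range b"]) auto
  then show "x = 0" using combination_basis(1) by (simp add: vec_eq_iff)
qed

lemma combination_surj: "\<exists>x. combination x = v"
proof -
  obtain c where c: "v = (\<Sum>w\<in>range b. smul (c w) w)"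
    using combination_basis(3) span_finite[of "range b"] by auto
  show ?thesis
    using c combination_basis(1)
    by (intro exI[of _ "\<chi> i. c (b i)"]) (simp add: combination_def sum.reindex)
qed

lemma linear_combination:
  assumes "Vector_Spaces.linear smul smul f"
  shows "f (combination x) = (\<Sum>i\<in>UNIV. smul (x $ i) (f (b i)))"
proof -
  interpret f: Vector_Spaces.linear smul smul f by fact
  show ?thesis by (simp add: combination_def f.sum f.scale)
qed

lemma mpoly_eval_form: "mpoly_eval p x = \<phi> (combination x)"
  using form by (simp add: is_form_def combination_def)

lemma homogeneous_form: "homogeneous d p"
  using form by (simp add: is_form_def)

lemma mul_add_right: "mul x (y + z) = mul x y + mul x z"
  and mul_scale_right: "mul x (smul c y) = smul c (mul x y)"
  using mul_linear[of x] by (auto simp: Vector_Spaces.linear_iff)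

lemma mul_add_left: "mul (y + z) x = mul y x + mul z x"
  and mul_scale_left: "mul (smul c y) x = smul c (mul y x)"
  using mul_add_right mul_scale_right by (simp_all add: mul_commute[of _ x])

text \<open>Splitting the two occurrences of \<open>v\<close> in \<open>{v w v}\<close> makes the expression linear in each
  argument, so that it is determined by its values on the basis.\<close>

definition trilinear_triple :: "'a \<Rightarrow> 'a \<Rightarrow> 'a \<Rightarrow> 'a" where
  "trilinear_triple v v' w = smul 2 (mul (mul v w) v') - mul w (mul v v')"

lemma trilinear_triple_linear:
  "Vector_Spaces.linear smul smul (\<lambda>v. trilinear_triple v v' w)"
  "Vector_Spaces.linear smul smul (\<lambda>v'. trilinear_triple v v' w)"
  "Vector_Spaces.linear smul smul (\<lambda>w. trilinear_triple v v' w)"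
  using vector_space_axioms
  by (simp_all add: Vector_Spaces.linear_iff trilinear_triple_def mul_add_left mul_add_right
      mul_scale_left mul_scale_right scale_right_distrib scale_right_diff_distrib
      scale_left_commute algebra_simps)

definition triple_constants :: "'n \<Rightarrow> 'n \<Rightarrow> 'n \<Rightarrow> 'k ^ 'n" where
  "triple_constants i j r = (SOME c. combination c = trilinear_triple (b i) (b j) (b r))"

lemma combination_triple_constants:
  "combination (triple_constants i j r) = trilinear_triple (b i) (b j) (b r)"
  unfolding triple_constants_def using combination_surj by (rule someI_ex)

text \<open>The product \<open>{x w x}\<close> of the algebra \<open>A \<otimes> l\<close> in coordinates.\<close>

definition extended_triple :: "('k \<Rightarrow> 'l::field) \<Rightarrow> 'l ^ 'n \<Rightarrow> 'l ^ 'n \<Rightarrow> 'l ^ 'n" where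
  "extended_triple \<iota> x w = (\<Sum>i\<in>UNIV. \<Sum>j\<in>UNIV. \<Sum>r\<in>UNIV.
     (x $ i * x $ j * w $ r) *s extend_point \<iota> (triple_constants i j r))"

lemma extended_triple_linear:
  fixes \<iota> :: "'k \<Rightarrow> 'l::field"
  shows "Vector_Spaces.linear (*s) (*s) (extended_triple \<iota> x)"
  unfolding Vector_Spaces.linear_iff
  by (auto simp: extended_triple_def vec.scale_sum_right distrib_left vec.scale_left_distrib
      sum.distrib mult_ac vec.vector_space_axioms)

lemma combination_triple:
  "combination (extended_triple id x w) = jordan_triple smul mul (combination x) (combination w)"
proof -
  have "jordan_triple smul mul (combination x) (combination w)
      = trilinear_triple (combination x) (combination x) (combination w)"
    by (simp add: jordan_triple_def trilinear_triple_def)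
  also have "\<dots> = (\<Sum>i\<in>UNIV. smul (x $ i) (\<Sum>j\<in>UNIV. smul (x $ j) (\<Sum>r\<in>UNIV. smul (w $ r)
      (trilinear_triple (b i) (b j) (b r)))))"
    unfolding linear_combination[OF trilinear_triple_linear(1)]
    unfolding linear_combination[OF trilinear_triple_linear(2)]
    unfolding linear_combination[OF trilinear_triple_linear(3)] ..
  also have "\<dots> = combination (extended_triple id x w)"
    by (simp add: extended_triple_def combination_sum combination_scale scale_sum_right mult_ac
        extend_point_def combination_triple_constants)
  finally show ?thesis by simp
qed

context
  fixes \<iota> :: "'k \<Rightarrow> 'l::field"
  assumes emb: "field_embedding \<iota>"
begin

lemma extended_triple_extend_point:
  "extended_triple \<iota> (extend_point \<iota> x) (extend_point \<iota> w) = extend_point \<iota> (extended_triple id x w)"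
  by (simp add: extended_triple_def vec_eq_iff embedding_simps[OF emb])

lemma extended_form_composition_base:
  "extend_form \<iota> p (extended_triple \<iota> (extend_point \<iota> x) (extend_point \<iota> w)) =
     (extend_form \<iota> p (extend_point \<iota> x))\<^sup>2 * extend_form \<iota> p (extend_point \<iota> w)"
  using composition
  by (simp add: extended_triple_extend_point extend_form_extend_point[OF emb] mpoly_eval_form
      combination_triple permits_jordan_composition_def embedding_simps[OF emb])

text \<open>A polynomial function that vanishes at all points with coordinates in the base field is zero,
  provided its degree stays within the bound \<open>2 d\<close> coming from the characteristic.\<close>

lemma zero_if_zero_on_base_field:
  fixes g :: "'l ^ 'n \<Rightarrow> 'l"
  assumes "polynomial_along_lines (2 * d) g" "\<And>x. g (extend_point \<iota> x) = 0"
  shows "g x = 0"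
proof (rule zero_if_zero_on_grid[OF assms(1)])
  show "2 * d < card (\<iota> ` of_nat ` {..2 * d})"
    by (simp add: card_of_nat_grid_extension[OF char emb])
next
  fix x :: "'l ^ 'n" assume "\<forall>i. x $ i \<in> \<iota> ` of_nat ` {..2 * d}"
  then have "\<forall>i. \<exists>c. x $ i = \<iota> c" by blast
  then obtain c where "\<And>i. x $ i = \<iota> (c i)" by metis
  then have "x = extend_point \<iota> (\<chi> i. c i)" by (simp add: vec_eq_iff)
  then show "g x = 0" using assms(2) by simp
qed

lemma extended_triple_along_line_degree:
  obtains q where "degree q \<le> 2 * d"
    "\<And>t. extend_form \<iota> p (extended_triple \<iota> (x + t *s y) w) = poly q t"
proof
  let ?P = "\<lambda>s. \<Sum>i\<in>UNIV. \<Sum>j\<in>UNIV. \<Sum>r\<in>UNIV.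
    smult (w $ r * \<iota> (triple_constants i j r $ s)) ([:x $ i, y $ i:] * [:x $ j, y $ j:])"
  have line: "degree [:x $ i, y $ i:] \<le> 1" for i by simp
  have "degree (?P s) \<le> 2" for s
    using degree_mult_le[of "[:x $ i, y $ i:]" "[:x $ j, y $ j:]" for i j] line
    by (intro degree_sum_le finite order_trans[OF degree_smult_le] order_trans[OF degree_mult_le]) auto
  then show "degree (form_along_curve \<iota> p ?P) \<le> 2 * d"
    by (rule degree_form_along_curve[OF homogeneous_form])
  have "extended_triple \<iota> (x + t *s y) w = (\<chi> s. poly (?P s) t)" for t
    by (simp add: extended_triple_def vec_eq_iff poly_sum algebra_simps)
  then show "extend_form \<iota> p (extended_triple \<iota> (x + t *s y) w) = poly (form_along_curve \<iota> p ?P) t" for t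
    by (simp add: poly_form_along_curve[OF emb])
qed

text \<open>The composition law is a polynomial identity of degree at most \<open>2 d\<close> in the first and \<open>d\<close> in
  the second argument, so it passes to the extension, first in one argument and then in the
  other.\<close>

lemma extended_form_composition:
  "extend_form \<iota> p (extended_triple \<iota> x w) = (extend_form \<iota> p x)\<^sup>2 * extend_form \<iota> p w"
proof -
  let ?F = "extend_form \<iota> p"
  have semi: "?F (extended_triple \<iota> x w) - (?F x)\<^sup>2 * ?F w = 0"
    if "w = extend_point \<iota> w0" for x w w0
  proof (rule zero_if_zero_on_base_field[where x = x])
    show "polynomial_along_lines (2 * d) (\<lambda>x. ?F (extended_triple \<iota> x w) - (?F x)\<^sup>2 * ?F w)"
      unfolding polynomial_along_lines_def
    proof (intro allI)
      fix x y
      obtain q where q: "degree q \<le> 2 * d" "\<And>t. ?F (extended_triple \<iota> (x + t *s y) w) = poly q t"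
        using extended_triple_along_line_degree[of x y w] by blast
      obtain q' where q': "degree q' \<le> d" "\<And>t. ?F (x + t *s y) = poly q' t"
        using form_along_line[OF emb homogeneous_form, of x y] by blast
      have "degree (smult (?F w) (q' ^ 2)) \<le> 2 * d"
        using degree_power_le[of q' 2] degree_smult_le[of "?F w" "q' ^ 2"] q'(1) by linarith
      then show "\<exists>q. degree q \<le> 2 * d \<and> (\<forall>t. ?F (extended_triple \<iota> (x + t *s y) w)
          - (?F (x + t *s y))\<^sup>2 * ?F w = poly q t)"
        using q q' by (intro exI[of _ "q - smult (?F w) (q' ^ 2)"]) (simp add: degree_diff_le)
    qed
  qed (simp add: that extended_form_composition_base)
  have "?F (extended_triple \<iota> x w) - (?F x)\<^sup>2 * ?F w = 0"
  proof (rule zero_if_zero_on_base_field[where x = w])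
    show "polynomial_along_lines (2 * d) (\<lambda>w. ?F (extended_triple \<iota> x w) - (?F x)\<^sup>2 * ?F w)"
      unfolding polynomial_along_lines_def
    proof (intro allI)
      fix w y
      interpret U: Vector_Spaces.linear "(*s)" "(*s)" "extended_triple \<iota> x" by (rule extended_triple_linear)
      obtain q where q: "degree q \<le> d"
          "\<And>t. ?F (extended_triple \<iota> x w + t *s extended_triple \<iota> x y) = poly q t"
        using form_along_line[OF emb homogeneous_form] by blast
      obtain q' where q': "degree q' \<le> d" "\<And>t. ?F (w + t *s y) = poly q' t"
        using form_along_line[OF emb homogeneous_form, of w y] by blast
      have "degree (smult ((?F x)\<^sup>2) q') \<le> 2 * d"
        using degree_smult_le[of "(?F x)\<^sup>2" q'] q'(1) by linarith
      then show "\<exists>q. degree q \<le> 2 * d \<and> (\<forall>t. ?F (extended_triple \<iota> x (w + t *s y))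
          - (?F x)\<^sup>2 * ?F (w + t *s y) = poly q t)"
        using q q' by (intro exI[of _ "q - smult ((?F x)\<^sup>2) q'"])
          (simp add: degree_diff_le U.add U.scale)
    qed
  qed (simp add: semi)
  then show ?thesis by simp
qed

lemma extended_form_unit: "\<exists>u. extend_form \<iota> p u = 1"
proof -
  obtain u where "combination u = e" using combination_surj by blast
  then have "extend_form \<iota> p (extend_point \<iota> u) = 1"
    using composition
    by (simp add: extend_form_extend_point[OF emb] mpoly_eval_form permits_jordan_composition_def
        embedding_one[OF emb])
  then show ?thesis by blast
qed

end

text \<open>Over the base field a vector orthogonal to all gradients lies in the radical: the pairing with
  the gradient at \<open>w\<close> is \<open>d\<close> times the first polar at \<open>w\<close>, and \<open>d\<close> is invertible.\<close>

lemma zero_if_orthogonal_to_gradients: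
  assumes orth: "\<And>w. (\<Sum>i\<in>UNIV. v $ i * partial_value id p i w) = 0"
  shows "v = 0"
proof -
  obtain \<theta> where sym: "symmetric_multilinear smul d \<theta>" and diag: "\<And>v. \<phi> v = \<theta> (replicate d v)"
    and nondeg: "\<And>v. (\<forall>vs. length vs = d - 1 \<longrightarrow> \<theta> (v # vs) = 0) \<Longrightarrow> v = 0"
    using nondegenerate unfolding nondegenerate_form_def by blast
  have char_d: "CHAR('k) = 0 \<or> CHAR('k) > d" using char by auto
  have polar: "\<theta> (combination v # replicate (d - 1) w) = 0" for w
  proof -
    obtain w0 where w0: "combination w0 = w" using combination_surj by blast
    obtain q where q: "degree q \<le> d" "\<And>t. extend_form id p (w0 + t *s v) = poly q t"
      "coeff q 1 = 0"
      using form_along_line[OF field_embedding_id homogeneous_form, of w0 v] orth by metis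
    obtain q' where q': "degree q' \<le> d"
      "coeff q' 1 = of_nat d * \<theta> (combination v # replicate (d - 1) w)"
      "\<And>t. \<theta> (replicate d (w + smul t (combination v))) = poly q' t"
      using multilinear_along_line[OF sym, of "[]" d w "combination v"] by auto
    have "poly (q - q') t = 0" for t
      using q(2)[of t] q'(3)[of t] w0
      by (simp add: mpoly_eval_extend_id[symmetric] mpoly_eval_form combination_add
          combination_scale diag)
    then have "q - q' = 0"
      using q(1) q'(1) card_of_nat_grid[OF char_d] degree_diff_le[of q d q']
      by (intro poly_zero_if_many_roots[of "q - q'" "of_nat ` {..d}"]) auto
    moreover have "\<not> CHAR('k) dvd d"
      using char degree_pos by (auto dest: dvd_imp_le)
    then have "(of_nat d :: 'k) \<noteq> 0"
      using of_nat_eq_0_iff_char_dvd by blast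
    ultimately show ?thesis using q(3) q'(2) by simp
  qed
  have "combination v = 0"
    using radical_if_first_polar_zero[OF sym char_d polar _ degree_pos] by (intro nondeg) simp
  then show "v = 0" by (rule combination_eq_0)
qed

context
  fixes \<iota> :: "'k \<Rightarrow> 'l::field"
  assumes emb: "field_embedding \<iota>"
begin

text \<open>Nondegeneracy survives the extension of scalars: the gradients at base field points have coordinates in \<open>k\<close>, so a
  \<open>k\<close>-linear functional \<open>l \<rightarrow> k\<close> applied to the coordinates of a vector orthogonal to them gives
  such a vector over \<open>k\<close>, and it can be chosen nonzero at any one nonzero coordinate.\<close>

lemma zero_if_translation_invariant:
  fixes v :: "'l ^ 'n"
  assumes inv: "\<And>w t. extend_form \<iota> p (w + t *s v) = extend_form \<iota> p w"
  shows "v = 0"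
proof (rule ccontr)
  assume "v \<noteq> 0"
  then obtain a where a: "v $ a \<noteq> 0" by (auto simp: vec_eq_iff)
  let ?s = "\<lambda>c x. \<iota> c * x"
  have orth: "(\<Sum>i\<in>UNIV. v $ i * \<iota> (partial_value id p i w)) = 0" for w
  proof -
    obtain q where q: "degree q \<le> d"
      "\<And>t. extend_form \<iota> p (extend_point \<iota> w + t *s v) = poly q t"
      "coeff q 1 = (\<Sum>i\<in>UNIV. v $ i * partial_value \<iota> p i (extend_point \<iota> w))"
      using form_along_line[OF emb homogeneous_form, of "extend_point \<iota> w" v] by blast
    define c where "c = extend_form \<iota> p (extend_point \<iota> w)"
    have "degree (q - [:c:]) \<le> d" using q(1) by (intro degree_diff_le) auto
    moreover have "poly (q - [:c:]) t = 0" for t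
      using inv q(2)[of t] by (simp add: c_def)
    ultimately have "q - [:c:] = 0"
      using card_of_nat_grid_extension[OF char emb]
      by (intro poly_zero_if_many_roots[of _ "\<iota> ` of_nat ` {..2 * d}"]) auto
    then have "coeff q 1 = 0" by simp
    then show ?thesis using q(3) by (simp add: partial_value_extend_point[OF emb])
  qed
  have l: "vector_space ?s"
    by unfold_locales (simp_all add: embedding_simps[OF emb] algebra_simps)
  have k: "vector_space ((*) :: 'k \<Rightarrow> 'k \<Rightarrow> 'k)"
    by unfold_locales (simp_all add: algebra_simps)
  interpret pair: vector_space_pair ?s "(*) :: 'k \<Rightarrow> 'k \<Rightarrow> 'k"
    using l k by (rule vector_space_pair.intro)
  have "pair.vs1.independent {v $ a}" using a by simp
  from pair.linear_independent_extend[OF this, of "\<lambda>_. 1"]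
  obtain h where h: "Vector_Spaces.linear ?s (*) h" "h (v $ a) = 1" by auto
  interpret h: Vector_Spaces.linear ?s "(*)" h by (rule h(1))
  have "(\<chi> i. h (v $ i)) = 0"
  proof (rule zero_if_orthogonal_to_gradients)
    fix w
    have "h (\<Sum>i\<in>UNIV. v $ i * \<iota> (partial_value id p i w)) = 0" by (simp add: orth h.zero)
    then have "(\<Sum>i\<in>UNIV. h (?s (partial_value id p i w) (v $ i))) = 0"
      by (simp add: h.sum mult.commute)
    then have "(\<Sum>i\<in>UNIV. partial_value id p i w * h (v $ i)) = 0"
      by (simp only: h.scale)
    then show "(\<Sum>i\<in>UNIV. (\<chi> i. h (v $ i)) $ i * partial_value id p i w) = 0"
      by (simp add: mult.commute)
  qed
  then show False using h(2) by (simp add: vec_eq_iff)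
qed

text \<open>By the composition law, translation by a vector in the kernel of \<open>w \<mapsto> {x w x}\<close> leaves the form
  unchanged.\<close>

lemma extended_triple_inj:
  assumes "extend_form \<iota> p x \<noteq> 0"
  shows "inj (extended_triple \<iota> x)"
proof -
  interpret U: Vector_Spaces.linear "(*s)" "(*s)" "extended_triple \<iota> x" by (rule extended_triple_linear)
  have "v = 0" if v: "extended_triple \<iota> x v = 0" for v
  proof (rule zero_if_translation_invariant)
    fix w t
    have "(extend_form \<iota> p x)\<^sup>2 * extend_form \<iota> p (w + t *s v)
        = (extend_form \<iota> p x)\<^sup>2 * extend_form \<iota> p w"
      by (simp add: extended_form_composition[OF emb, symmetric] U.add U.scale v)
    then show "extend_form \<iota> p (w + t *s v) = extend_form \<iota> p w"
      using assms by simp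
  qed
  then show ?thesis by (simp add: U.inj_iff_eq_0)
qed

lemma square_of_value_in_G_set:
  assumes "a \<in> D_set (extend_form \<iota> p)"
  shows "a\<^sup>2 \<in> G_set (extend_form \<iota> p)"
proof -
  obtain x where x: "extend_form \<iota> p x = a" "a \<noteq> 0" using assms by (auto simp: D_set_def)
  then show ?thesis
    using extended_triple_linear extended_triple_inj extended_form_composition[OF emb]
    by (intro similarity_in_G_set[of "extended_triple \<iota> x"]) auto
qed

lemma value_in_G_set:
  assumes "odd d" "a \<in> D_set (extend_form \<iota> p)"
  shows "a \<in> G_set (extend_form \<iota> p)"
proof -
  obtain x where x: "extend_form \<iota> p x = a" "a \<noteq> 0" using assms by (auto simp: D_set_def)
  then show ?thesis
    using extended_triple_linear extended_triple_inj extended_form_composition[OF emb]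
      extend_form_scale[OF emb homogeneous_form] assms(1)
    by (intro odd_degree_similarity[of "extended_triple \<iota> x"]) auto
qed

text \<open>The image of the unit under a similarity is a vector whose value is the multiplier.\<close>

lemma multiplier_in_D_set:
  assumes "a \<in> G_set (extend_form \<iota> p)"
  shows "a \<in> D_set (extend_form \<iota> p)"
proof -
  obtain f where "a \<noteq> 0" "\<And>v. extend_form \<iota> p (f v) = a * extend_form \<iota> p v"
    using assms by (auto simp: G_set_def forms_isomorphic_def)
  moreover obtain u where "extend_form \<iota> p u = 1" using extended_form_unit[OF emb] by blast
  ultimately show ?thesis unfolding D_set_def by (metis (mono_tags, lifting) mem_Collect_eq mult.right_neutral)
qed

end

end

section \<open>The generic value\<close>

lemma field_embedding_ratfun_const:
  "field_embedding (ratfun_const :: 'k::field \<Rightarrow> ('n::{finite,linorder}, 'k) ratfun)"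
  by (simp add: field_embedding_def ratfun_const_def Poly_Mapping.single_add mult_single
      One_fract_def)

lemma Fract_sum: "(\<Sum>s\<in>S. Fract (f s) 1) = Fract (sum f S) (1 :: 'r::idom)"
  by (induction S rule: infinite_finite_induct) (simp_all add: Zero_fract_def)

lemma Fract_prod: "(\<Prod>s\<in>S. Fract (f s) 1) = Fract (prod f S) (1 :: 'r::idom)"
  by (induction S rule: infinite_finite_induct) (simp_all add: One_fract_def)

lemma Fract_power: "Fract x 1 ^ n = Fract (x ^ n) (1 :: 'r::idom)"
  by (induction n) (simp_all add: One_fract_def)

lemma prod_single:
  "(\<Prod>s\<in>S. Poly_Mapping.single (f s) (1 :: 'k::field)) = Poly_Mapping.single (\<Sum>s\<in>S. f s) 1"
  by (induction S rule: infinite_finite_induct) (simp_all add: mult_single)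

lemma power_single_exponent:
  "Poly_Mapping.single (Poly_Mapping.single i 1) (1 :: 'k::field) ^ n =
     Poly_Mapping.single (Poly_Mapping.single i n) 1"
  by (induction n) (simp_all add: mult_single Poly_Mapping.single_add[symmetric])

lemma sum_single_lookup:
  assumes "finite S" "Poly_Mapping.keys f \<subseteq> S"
  shows "(\<Sum>s\<in>S. Poly_Mapping.single s (Poly_Mapping.lookup f s)) = f"
  using assms
  by (intro poly_mapping_eqI)
    (auto simp: lookup_sum lookup_single when_def Poly_Mapping.in_keys_iff)

text \<open>By linearity it suffices to substitute the indeterminates into a monomial, where the powers of
  single indeterminates multiply up to the monomial again.\<close>

lemma generic_value_eq_Fract:
  fixes p :: "('n::{finite,linorder}, 'k::field) mpoly"
  shows "generic_value p = Fract p 1"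
proof -
  have monomial: "(\<Prod>i\<in>UNIV. (ratfun_var i :: ('n, 'k) ratfun) ^ Poly_Mapping.lookup m i)
      = Fract (Poly_Mapping.single m 1) 1" for m
    by (simp only: ratfun_var_def Fract_power power_single_exponent Fract_prod prod_single
        sum_single_lookup finite subset_UNIV)
  have "generic_value p = (\<Sum>m\<in>Poly_Mapping.keys p.
      Fract (Poly_Mapping.single m (Poly_Mapping.lookup p m)) 1)"
    by (simp add: generic_value_def extend_generic_def monomial ratfun_const_def mult_single
        extend_form_expand[OF field_embedding_ratfun_const])
  also have "\<dots> = Fract p 1"
    by (simp only: Fract_sum sum_single_lookup finite_keys order_refl)
  finally show ?thesis .
qed

lemma generic_value_nonzero: "p \<noteq> 0 \<Longrightarrow> generic_value p \<noteq> 0"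
  by (simp add: generic_value_eq_Fract Zero_fract_def eq_fract)

section \<open>Values and multipliers over extension fields\<close>

theorem proposition2:
  fixes smul :: "'k::field \<Rightarrow> 'a::ab_group_add \<Rightarrow> 'a"
    and mul :: "'a \<Rightarrow> 'a \<Rightarrow> 'a" and e :: 'a
    and b :: "'n::{finite,linorder} \<Rightarrow> 'a"
    and d :: nat
    and p :: "('n, 'k) mpoly"
    and \<phi> :: "'a \<Rightarrow> 'k"
  assumes "d \<ge> 1"
    and "CHAR('k) = 0 \<or> CHAR('k) > 2 * d"
    and "unital_jordan_algebra smul mul e"
    and "indexed_basis smul b"
    and "is_form smul b d p \<phi>"
    and "nondegenerate_form smul d \<phi>"
    and "permits_jordan_composition smul mul e \<phi>"
  shows "((\<forall>\<iota> :: 'k \<Rightarrow> 'l::field. field_embedding \<iota> \<longrightarrow>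
             {a\<^sup>2 | a. a \<in> D_set (extend_form \<iota> p)} \<subseteq> G_set (extend_form \<iota> p)) \<and>
          strongly_jordan_multiplicative p) \<and>
         (odd d \<longrightarrow>
           (\<forall>\<iota> :: 'k \<Rightarrow> 'l. field_embedding \<iota> \<longrightarrow>
              D_set (extend_form \<iota> p) = G_set (extend_form \<iota> p) \<and> round_form (extend_form \<iota> p)) \<and>
           strongly_multiplicative p)"
proof -
  interpret unital_jordan_algebra smul mul e by fact
  interpret jordan_composition_form smul mul e b d p \<phi>
    by unfold_locales fact+
  have "p \<noteq> 0"
    using extended_form_unit[OF field_embedding_id]
    by (auto simp: extend_form_expand[OF field_embedding_id])
  then have generic: "generic_value p \<in> D_set (extend_generic p)"
    using generic_value_nonzero by (auto simp: D_set_def generic_value_def)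
  have "strongly_jordan_multiplicative p"
    using square_of_value_in_G_set[OF field_embedding_ratfun_const generic[unfolded extend_generic_def]]
    by (simp add: strongly_jordan_multiplicative_def extend_generic_def G_set_def)
  moreover have "strongly_multiplicative p" if "odd d"
    using value_in_G_set[OF field_embedding_ratfun_const that generic[unfolded extend_generic_def]]
    by (simp add: strongly_multiplicative_def extend_generic_def G_set_def)
  moreover have "{a\<^sup>2 | a. a \<in> D_set (extend_form \<iota> p)} \<subseteq> G_set (extend_form \<iota> p)"
    if "field_embedding \<iota>" for \<iota> :: "'k \<Rightarrow> 'l"
    using square_of_value_in_G_set[OF that] by blast
  moreover have "D_set (extend_form \<iota> p) = G_set (extend_form \<iota> p)"
    if "field_embedding \<iota>" "odd d" for \<iota> :: "'k \<Rightarrow> 'l"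
    using value_in_G_set[OF that] multiplier_in_D_set[OF that(1)] by blast
  ultimately show ?thesis by (simp add: round_form_def)
qed

end
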